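(* For every integer $k\ge 3$ there is an absolute constant $c>0$ such that for all sufficiently large $n$ there is a $(k-1)$-graph $G$ on $n$ vertices with at least $(1-o(1))\binom{n}{k-1}$ edges (where $o(1)$ denotes a quantity tending to $0$ as $n\to\infty$), whose edge set can be decomposed into at most $n^{1+c/\log\log n}$ induced subgraphs, each being a partial Steiner system.
   Context: A $(k-1)$-graph is a $(k-1)$-uniform hypergraph. A $(k-1)$-graph is a partial Steiner system (a partial Steiner system $S(k-2,k-1)$) if no two of its edges share $k-2$ common vertices, i.e., every $(k-2)$-subset of vertices is contained in at most one edge. Decomposing the edge set of $G$ into induced subgraphs each being a partial Steiner system means partitioning the edge set into classes $E_1,\dots,E_m$ such that each $E_i$ is the full edge set of the subgraph of $G$ induced on the vertices covered by $E_i$, and each $E_i$ forms a partial Steiner system. *)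

theory Defs
  imports Complex_Main "HOL-Library.Ramsey" "HOL-Library.Disjoint_Sets"
begin

text \<open>Throughout, a hypergraph is given by its vertex set \<open>V\<close> and its edge set \<open>E\<close>;
  an \<open>r\<close>-graph is an \<open>r\<close>-uniform hypergraph.\<close>

definition uniform_hypergraph :: "nat \<Rightarrow> 'a set \<Rightarrow> 'a set set \<Rightarrow> bool" where
  "uniform_hypergraph r V E \<longleftrightarrow> finite V \<and> E \<subseteq> [V]\<^bsup>r\<^esup>"

text \<open>Partial Steiner system \<open>S(t, r)\<close> on the vertex set \<open>V\<close>.\<close>

definition partial_steiner_system :: "nat \<Rightarrow> nat \<Rightarrow> 'a set \<Rightarrow> 'a set set \<Rightarrow> bool" where
  "partial_steiner_system t r V E \<longleftrightarrow>
     uniform_hypergraph r V E \<and> (\<forall>T\<in>[V]\<^bsup>t\<^esup>. \<exists>\<^sub>\<le>\<^sub>1 e. e \<in> E \<and> T \<subseteq> e)"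

definition induced_edges :: "'a set set \<Rightarrow> 'a set \<Rightarrow> 'a set set" where
  "induced_edges E W = {e \<in> E. e \<subseteq> W}"

text \<open>A decomposition is represented by the set \<open>P\<close> of its (nonempty) edge classes; the subgraph
  belonging to a class \<open>C\<close> has as vertices exactly those covered by \<open>C\<close>, that is \<open>\<Union>C\<close>.\<close>

definition induced_steiner_decomposition ::
    "nat \<Rightarrow> nat \<Rightarrow> 'a set set \<Rightarrow> 'a set set set \<Rightarrow> bool" where
  "induced_steiner_decomposition t r E P \<longleftrightarrow>
     partition_on E P \<and>
     (\<forall>C\<in>P. C = induced_edges E (\<Union>C) \<and> partial_steiner_system t r (\<Union>C) C)"

end

theory Submission
  imports Defs
begin

text \<open>With \<open>r = k - 1\<close>, vertices are points of the cube \<open>{0..<C}\<^sup>m\<close>, and the edges are the \<open>r\<close>-sets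
  that are nearly regular simplices of the typical squared side length \<open>\<tau>\<close>; by Chebyshev's
  inequality almost all \<open>r\<close>-sets qualify. Group the edges by their vector sum \<open>w\<close>: two edges with the
  same sum cannot share \<open>r - 1\<close> vertices. All vertices of a group lie at nearly the same distance from
  \<open>w / r\<close>, and the identity
  \<open>|\<Sum> y|\<^sup>2 = r \<Sum> |y|\<^sup>2 - \<Sum> |y - y'|\<^sup>2\<close> (last sum over unordered pairs) shows that any other edge on
  these vertices has a sum at squared distance only \<open>O(m)\<close> from \<open>w\<close>. Refining the groups by the values
  on the vertices of a linear form that does not vanish on nonzero integer vectors of squared length
  \<open>O(m)\<close> separates such sums and makes the groups induced. There are \<open>C\<^sup>m\<close> sums up to a factor
  exponential in \<open>m\<close>, and as many values of the form as an exponential in \<open>m\<close>; choosing \<open>C\<close> as a small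
  power of \<open>ln n\<close> gives \<open>m = O(ln n / ln (ln n))\<close>. A general number \<open>n\<close> of vertices is reached by
  passing to an average-density subset of the cube.\<close>

section \<open>Base-\<open>C\<close> digits and second moments over the cube\<close>

text \<open>Numbers below \<open>C ^ m\<close> encode the points of the cube, with
  \<open>digit C v\<close> as the coordinate vector of \<open>v\<close>. This keeps the vertex type
  \<open>nat\<close>.\<close>

definition digit :: "nat \<Rightarrow> nat \<Rightarrow> nat \<Rightarrow> nat" where
  "digit C v i = v div C ^ i mod C"

lemma digit_0: "digit C v 0 = v mod C"
  by (simp add: digit_def)

lemma digit_Suc: "digit C v (Suc i) = digit C (v div C) i"
  by (simp add: digit_def div_mult2_eq)

lemma digit_less: "C > 0 \<Longrightarrow> digit C v i < C"
  by (simp add: digit_def)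

lemma digit_inject:
  assumes "u < C ^ m" "v < C ^ m" "\<And>i. i < m \<Longrightarrow> digit C u i = digit C v i"
  shows "u = v"
  using assms
proof (induction m arbitrary: u v)
  case 0
  then show ?case by simp
next
  case (Suc m)
  have "u div C = v div C"
  proof (rule Suc.IH)
    show "u div C < C ^ m" "v div C < C ^ m"
      using Suc.prems(1,2) by (auto simp: less_mult_imp_div_less mult.commute)
    show "digit C (u div C) i = digit C (v div C) i" if "i < m" for i
      using Suc.prems(3)[of "Suc i"] that by (simp add: digit_Suc)
  qed
  moreover have "u mod C = v mod C"
    using Suc.prems(3)[of 0] by (simp add: digit_0)
  ultimately show ?case by (metis div_mult_mod_eq)
qed

lemma sum_lessThan_mult:
  fixes F :: "nat \<Rightarrow> 'a :: comm_monoid_add"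
  shows "sum F {..<M * C} = (\<Sum>v<M. \<Sum>a<C. F (v * C + a))"
proof -
  have "sum F {..<M * C} = (\<Sum>v<M. sum F {v * C..<v * C + C})"
    by (simp add: sum.nat_group)
  also have "\<dots> = (\<Sum>v<M. \<Sum>a<C. F (v * C + a))"
  proof (rule sum.cong[OF refl])
    fix v
    show "sum F {v * C..<v * C + C} = (\<Sum>a<C. F (v * C + a))"
      using sum.shift_bounds_nat_ivl[of F 0 "v * C" C]
      by (simp only: add.commute add_0_left atLeast0LessThan)
  qed
  finally show ?thesis .
qed

text \<open>The coordinates of a uniformly random pair of points are independent and
  \<open>g\<close> has mean zero in each, so the cross terms vanish and the variances, each at most
  \<open>L\<^sup>2\<close>, add up. The induction on \<open>m\<close> splits off the last digit of
  both points.\<close>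

lemma digit_second_moment:
  fixes g :: "nat \<Rightarrow> nat \<Rightarrow> real"
  assumes C: "C > 0"
    and mean: "(\<Sum>a<C. \<Sum>b<C. g a b) = 0"
    and bound: "\<And>a b. a < C \<Longrightarrow> b < C \<Longrightarrow> \<bar>g a b\<bar> \<le> L"
  shows "(\<Sum>u<C ^ m. \<Sum>v<C ^ m. (\<Sum>i<m. g (digit C u i) (digit C v i))\<^sup>2)
    \<le> real m * L\<^sup>2 * (real (C ^ m))\<^sup>2"
proof (induction m)
  case 0
  then show ?case by simp
next
  case (Suc m)
  define s where "s u v = (\<Sum>i<m. g (digit C u i) (digit C v i))" for u v
  have split: "(\<Sum>i<Suc m. g (digit C (u * C + a) i) (digit C (v * C + b) i)) = g a b + s u v"
    if "a < C" "b < C" for u v a b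
    using that by (simp add: sum.lessThan_Suc_shift digit_0 digit_Suc s_def del: sum.lessThan_Suc)
  have sq: "(\<Sum>a<C. \<Sum>b<C. (g a b)\<^sup>2) \<le> (real C)\<^sup>2 * L\<^sup>2"
  proof -
    have "(\<Sum>a<C. \<Sum>b<C. (g a b)\<^sup>2) \<le> (\<Sum>a<C. \<Sum>b<C. L\<^sup>2)"
      by (intro sum_mono) (metis bound lessThan_iff power2_abs power_mono abs_ge_zero)
    then show ?thesis by (simp add: power2_eq_square)
  qed
  have inner: "(\<Sum>a<C. \<Sum>b<C. (g a b + s u v)\<^sup>2) \<le> (real C)\<^sup>2 * L\<^sup>2 + (real C)\<^sup>2 * (s u v)\<^sup>2" for u v
  proof -
    have "(\<Sum>a<C. \<Sum>b<C. (g a b + s u v)\<^sup>2)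
        = (\<Sum>a<C. \<Sum>b<C. (g a b)\<^sup>2) + 2 * s u v * (\<Sum>a<C. \<Sum>b<C. g a b) + (real C)\<^sup>2 * (s u v)\<^sup>2"
    proof -
      have "(g a b + s u v)\<^sup>2 = (g a b)\<^sup>2 + 2 * s u v * g a b + (s u v)\<^sup>2" for a b
        by (simp add: power2_sum)
      then show ?thesis
        by (simp add: sum.distrib sum_distrib_left power2_eq_square)
    qed
    then show ?thesis using sq mean by simp
  qed
  have "(\<Sum>u<C ^ Suc m. \<Sum>v<C ^ Suc m. (\<Sum>i<Suc m. g (digit C u i) (digit C v i))\<^sup>2)
      = (\<Sum>u<C ^ m. \<Sum>a<C. \<Sum>v<C ^ m. \<Sum>b<C.
          (\<Sum>i<Suc m. g (digit C (u * C + a) i) (digit C (v * C + b) i))\<^sup>2)"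
    by (simp only: power_Suc2 sum_lessThan_mult)
  also have "\<dots> = (\<Sum>u<C ^ m. \<Sum>a<C. \<Sum>v<C ^ m. \<Sum>b<C. (g a b + s u v)\<^sup>2)"
    by (intro sum.cong refl) (simp only: split lessThan_iff)
  also have "\<dots> = (\<Sum>u<C ^ m. \<Sum>v<C ^ m. \<Sum>a<C. \<Sum>b<C. (g a b + s u v)\<^sup>2)"
    by (intro sum.cong refl sum.swap)
  also have "\<dots> \<le> (\<Sum>u<C ^ m. \<Sum>v<C ^ m. (real C)\<^sup>2 * L\<^sup>2 + (real C)\<^sup>2 * (s u v)\<^sup>2)"
    by (intro sum_mono inner)
  also have "\<dots> = (real (C ^ m))\<^sup>2 * (real C)\<^sup>2 * L\<^sup>2 + (real C)\<^sup>2 * (\<Sum>u<C ^ m. \<Sum>v<C ^ m. (s u v)\<^sup>2)"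
    by (simp add: sum.distrib sum_distrib_left power2_eq_square)
  also have "\<dots> \<le> (real (C ^ m))\<^sup>2 * (real C)\<^sup>2 * L\<^sup>2 + (real C)\<^sup>2 * (real m * L\<^sup>2 * (real (C ^ m))\<^sup>2)"
    using Suc.IH unfolding s_def by (intro add_left_mono mult_left_mono) auto
  also have "\<dots> = real (Suc m) * L\<^sup>2 * (real (C ^ Suc m))\<^sup>2"
    by (simp add: algebra_simps power_mult_distrib)
  finally show ?case .
qed

section \<open>Linear forms that do not vanish on short integer vectors\<close>

text \<open>The range of the coefficients depends only on the number of vectors to be avoided, not
  on their entries. An exponential bound on that number therefore gives coefficients that are at
  most exponential in \<open>m\<close>.\<close>

lemma exists_nonvanishing_linear_form:
  fixes B :: "(nat \<Rightarrow> int) set"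
  assumes "finite B" "card B < A"
  shows "\<exists>\<alpha>::nat \<Rightarrow> nat. (\<forall>i. \<alpha> i < A) \<and>
    (\<forall>\<delta>\<in>B. (\<exists>i<m. \<delta> i \<noteq> 0) \<longrightarrow> (\<Sum>i<m. int (\<alpha> i) * \<delta> i) \<noteq> 0)"
proof (induction m)
  case 0
  have "(\<forall>i. (\<lambda>_. 0) i < A)" using assms by simp
  then show ?case by (intro exI[of _ "\<lambda>_. 0"]) auto
next
  case (Suc m)
  then obtain \<alpha> :: "nat \<Rightarrow> nat" where \<alpha>: "\<And>i. \<alpha> i < A"
    "\<And>\<delta>. \<delta> \<in> B \<Longrightarrow> \<exists>i<m. \<delta> i \<noteq> 0 \<Longrightarrow> (\<Sum>i<m. int (\<alpha> i) * \<delta> i) \<noteq> 0"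
    by blast
  \<comment> \<open>Each \<open>\<delta>\<close> excludes at most one value of the new coefficient.\<close>
  define root where "root \<delta> = nat (- (\<Sum>i<m. int (\<alpha> i) * \<delta> i) div \<delta> m)" for \<delta>
  have "card (root ` B) < card {..<A}"
    using card_image_le[OF assms(1), of root] assms(2) by simp
  then obtain t where t: "t < A" "t \<notin> root ` B"
    by (metis assms(1) card_mono finite_imageI lessThan_iff linorder_not_less subsetI)
  have "(\<Sum>i<Suc m. int ((\<alpha>(m := t)) i) * \<delta> i) \<noteq> 0"
    if "\<delta> \<in> B" "\<exists>i<Suc m. \<delta> i \<noteq> 0" for \<delta>
  proof
    assume "(\<Sum>i<Suc m. int ((\<alpha>(m := t)) i) * \<delta> i) = 0"
    then have z: "(\<Sum>i<m. int (\<alpha> i) * \<delta> i) + int t * \<delta> m = 0" by simp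
    show False
    proof (cases "\<delta> m = 0")
      case True
      then have "\<exists>i<m. \<delta> i \<noteq> 0" using that(2) less_Suc_eq by auto
      then show False using \<alpha>(2) that(1) z True by simp
    next
      case False
      have "- (\<Sum>i<m. int (\<alpha> i) * \<delta> i) = int t * \<delta> m" using z by simp
      then have "root \<delta> = t" using False by (simp add: root_def)
      then show False using t that(1) by blast
    qed
  qed
  moreover have "(\<alpha>(m := t)) i < A" for i using \<alpha>(1) t(1) by simp
  ultimately show ?case by (intro exI[of _ "\<alpha>(m := t)"]) blast
qed

text \<open>A two-sided geometric series with limit 3. The right-hand side is its exact value, which
  lets the induction go through.\<close>

lemma sum_half_power_abs_le: "(\<Sum>j = - int s..int s. (1 / 2 :: real) ^ nat \<bar>j\<bar>) \<le> 3 - 2 * (1 / 2) ^ s"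
proof (induction s)
  case 0
  then show ?case by simp
next
  case (Suc s)
  have "{- int (Suc s)..int (Suc s)} = insert (int (Suc s)) (insert (- int (Suc s)) {- int s..int s})"
    by auto
  then have "(\<Sum>j = - int (Suc s)..int (Suc s). (1 / 2 :: real) ^ nat \<bar>j\<bar>)
      = 2 * (1 / 2) ^ Suc s + (\<Sum>j = - int s..int s. (1 / 2) ^ nat \<bar>j\<bar>)"
    by (simp add: nat_add_distrib)
  then show ?case using Suc by simp
qed

text \<open>For \<open>s\<close> linear in \<open>m\<close> this is exponential in \<open>m\<close>,
  while the surrounding box has \<open>(2 * s + 1) ^ m\<close> points, too many for the final
  count.\<close>

lemma card_l1_ball_le:
  "card {\<delta> \<in> PiE {..<m} (\<lambda>_. {- int s..int s}). (\<Sum>i<m. \<bar>\<delta> i\<bar>) \<le> int s} \<le> 3 ^ m * 2 ^ s"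
    (is "card ?B \<le> _")
proof -
  have fin: "finite (PiE {..<m} (\<lambda>_. {- int s..int s}))"
    by (intro finite_PiE) auto
  \<comment> \<open>Weight \<open>\<delta>\<close> by \<open>2\<close> to the power \<open>- |\<delta>|\<close>: the total weight factors over the coordinates.\<close>
  have "real (card ?B) * (1 / 2) ^ s = (\<Sum>\<delta>\<in>?B. (1 / 2) ^ s)" by simp
  also have "\<dots> \<le> (\<Sum>\<delta>\<in>?B. \<Prod>i<m. (1 / 2) ^ nat \<bar>\<delta> i\<bar>)"
  proof (intro sum_mono)
    fix \<delta> assume "\<delta> \<in> ?B"
    then have "int (\<Sum>i<m. nat \<bar>\<delta> i\<bar>) \<le> int s" by simp
    then have "(\<Sum>i<m. nat \<bar>\<delta> i\<bar>) \<le> s" by (simp only: of_nat_le_iff)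
    then show "(1 / 2 :: real) ^ s \<le> (\<Prod>i<m. (1 / 2) ^ nat \<bar>\<delta> i\<bar>)"
      unfolding power_sum[symmetric] by (intro power_decreasing) auto
  qed
  also have "\<dots> \<le> (\<Sum>\<delta>\<in>PiE {..<m} (\<lambda>_. {- int s..int s}). \<Prod>i<m. (1 / 2) ^ nat \<bar>\<delta> i\<bar>)"
    by (intro sum_mono2 fin) (blast, simp add: prod_nonneg)
  also have "\<dots> = (\<Prod>i<m. \<Sum>j = - int s..int s. (1 / 2) ^ nat \<bar>j\<bar>)"
    by (rule prod_sum_PiE[symmetric]) auto
  also have "\<dots> \<le> (\<Prod>i<m. 3)"
  proof (rule prod_mono, intro conjI, rule sum_nonneg)
    show "(\<Sum>j = - int s..int s. (1 / 2 :: real) ^ nat \<bar>j\<bar>) \<le> 3"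
      using sum_half_power_abs_le[of s] by (rule order_trans) simp
  qed auto
  finally have "real (card ?B) \<le> 3 ^ m * 2 ^ s"
    by (simp add: power_divide field_simps)
  then have "real (card ?B) \<le> real (3 ^ m * 2 ^ s)" by simp
  then show ?thesis by (simp only: of_nat_le_iff)
qed

section \<open>Thinning the vertex set and avoiding forbidden subsets\<close>

text \<open>Some \<open>N\<close>-subset has at most the average density of \<open>B\<close>. It is
  reached by deleting vertices one at a time, and the densities are compared in product form to
  avoid division.\<close>

lemma exists_sparse_subset:
  fixes X :: "'a set"
  assumes "finite X" "B \<subseteq> [X]\<^bsup>s\<^esup>" "N \<le> card X"
  shows "\<exists>W\<subseteq>X. card W = N \<and> card (B \<inter> [W]\<^bsup>s\<^esup>) * (card X choose s) \<le> card B * (N choose s)"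
  using assms
proof (induction "card X - N" arbitrary: X B)
  case 0
  then have "B \<inter> [X]\<^bsup>s\<^esup> = B" "card X = N" by auto
  then show ?case by (intro exI[of _ X]) auto
next
  case (Suc d)
  define M where "M = card X"
  have MN: "N < M" using Suc.hyps(2) by (simp add: M_def)
  have finB: "finite B" using Suc.prems finite_imp_finite_nsets finite_subset by blast
  show ?case
  proof (cases "N < s")
    \<comment> \<open>Now no \<open>s\<close>-subset fits into \<open>W\<close>, so any
      \<open>W\<close> of the right size works. In the other case \<open>s \<le> N < M\<close>, so
      the factor \<open>M - s\<close> can be cancelled at the end.\<close>
    case True
    obtain W where W: "W \<subseteq> X" "card W = N" using Suc.prems(3) by (meson obtain_subset_with_card_n)
    moreover have "[W]\<^bsup>s\<^esup> = {}"
      using W True Suc.prems(1) by (intro nsets_eq_empty) (auto intro: finite_subset)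
    ultimately show ?thesis by (intro exI[of _ W]) auto
  next
    case False
    \<comment> \<open>Deleting a vertex of at least average degree does not increase the density.\<close>
    define deg where "deg v = card {b \<in> B. v \<in> b}" for v
    have "card {v \<in> X. v \<in> b} = s" if "b \<in> B" for b
    proof -
      have "{v \<in> X. v \<in> b} = b" using Suc.prems(2) that by (auto simp: nsets_def)
      then show ?thesis using Suc.prems(2) that by (auto simp: nsets_def)
    qed
    then have degsum: "sum deg X = s * card B"
      unfolding deg_def using Suc.prems(1) finB by (intro sum_multicount) auto
    have "\<exists>v\<in>X. s * card B \<le> M * deg v"
    proof (rule ccontr)
      assume "\<not> ?thesis"
      then have "\<And>v. v \<in> X \<Longrightarrow> M * deg v < s * card B" by force
      then have "(\<Sum>v\<in>X. M * deg v) < (\<Sum>v\<in>X. s * card B)"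
        using Suc.prems(1) MN M_def by (intro sum_strict_mono) auto
      then show False using degsum by (simp add: M_def flip: sum_distrib_left)
    qed
    then obtain v where v: "v \<in> X" "s * card B \<le> M * deg v" by blast
    define B' where "B' = {b \<in> B. v \<notin> b}"
    have "B = B' \<union> {b \<in> B. v \<in> b}" by (auto simp: B'_def)
    then have "card B = card B' + deg v"
      unfolding deg_def using finB by (subst card_Un_disjoint[symmetric]) (auto simp: B'_def)
    then have "M * card B' + M * deg v = M * card B" by (simp add: algebra_simps)
    then have B': "M * card B' \<le> (M - s) * card B" using v(2) by (simp add: diff_mult_distrib)
    have cX': "card (X - {v}) = M - 1" using v(1) Suc.prems(1) by (simp add: M_def)
    have "\<exists>W\<subseteq>X - {v}. card W = N \<and>
        card (B' \<inter> [W]\<^bsup>s\<^esup>) * (card (X - {v}) choose s) \<le> card B' * (N choose s)"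
      using Suc.prems Suc.hyps(2) MN cX'
      by (intro Suc.hyps(1)) (auto simp: B'_def nsets_def M_def)
    then obtain W where W: "W \<subseteq> X - {v}" "card W = N"
      "card (B' \<inter> [W]\<^bsup>s\<^esup>) * (M - 1 choose s) \<le> card B' * (N choose s)"
      using cX' by auto
    have eq: "B' \<inter> [W]\<^bsup>s\<^esup> = B \<inter> [W]\<^bsup>s\<^esup>" using W(1) by (auto simp: B'_def nsets_def)
    \<comment> \<open>The number of \<open>s\<close>-sets shrinks by exactly the ratio
      \<open>(M - s) / M\<close> that bounds the shrinking of \<open>B\<close>.\<close>
    have ch: "(M - s) * (M choose s) = M * (M - 1 choose s)"
      using MN binomial_absorb_comp[of M s] by simp
    have "(M - s) * (card (B \<inter> [W]\<^bsup>s\<^esup>) * (M choose s)) = M * (card (B' \<inter> [W]\<^bsup>s\<^esup>) * (M - 1 choose s))"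
      using ch eq by (metis mult.left_commute)
    also have "\<dots> \<le> M * (card B' * (N choose s))" using W(3) by (rule mult_le_mono2)
    also have "\<dots> \<le> (M - s) * (card B * (N choose s))"
      using mult_le_mono1[OF B', of "N choose s"] by (simp add: mult.assoc)
    finally have "card (B \<inter> [W]\<^bsup>s\<^esup>) * (M choose s) \<le> card B * (N choose s)"
      using MN False by simp
    then show ?thesis using W unfolding M_def by (intro exI[of _ W]) auto
  qed
qed

lemma card_nsets_containing_le:
  assumes "finite W" "p \<in> [W]\<^bsup>s\<^esup>"
  shows "card {e \<in> [W]\<^bsup>r\<^esup>. p \<subseteq> e} \<le> (card W - s) choose (r - s)"
proof -
  have p: "p \<subseteq> W" "finite p" "card p = s" using assms(2) by (auto simp: nsets_def)
  have "card {e \<in> [W]\<^bsup>r\<^esup>. p \<subseteq> e} \<le> card (nsets (W - p) (r - s))"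
  proof (rule card_inj_on_le)
    show "inj_on (\<lambda>e. e - p) {e \<in> [W]\<^bsup>r\<^esup>. p \<subseteq> e}" by (auto simp: inj_on_def)
    show "(\<lambda>e. e - p) ` {e \<in> [W]\<^bsup>r\<^esup>. p \<subseteq> e} \<subseteq> nsets (W - p) (r - s)"
      using p by (auto simp: nsets_def card_Diff_subset)
    show "finite (nsets (W - p) (r - s))" using assms(1) by (simp add: finite_imp_finite_nsets)
  qed
  then show ?thesis using p assms(1) by (simp add: card_nsets card_Diff_subset)
qed

text \<open>Union bound over \<open>B\<close>: by the identity \<open>choose_mult\<close>, double
  counting pairs of an \<open>s\<close>-set inside an \<open>r\<close>-set, a density
  \<open>\<beta>\<close> of forbidden sets spoils at most the fraction
  \<open>\<beta> * (r choose s)\<close> of the \<open>r\<close>-sets.\<close>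

lemma card_nsets_avoiding_ge:
  assumes "finite W" "B \<subseteq> [W]\<^bsup>s\<^esup>" "s \<le> r" "real (card B) \<le> \<beta> * real (card W choose s)"
  shows "real (card {e \<in> [W]\<^bsup>r\<^esup>. \<forall>p\<in>B. \<not> p \<subseteq> e}) \<ge> (1 - \<beta> * real (r choose s)) * real (card W choose r)"
proof (cases "r \<le> card W")
  case True
  have finB: "finite B" using assms finite_imp_finite_nsets finite_subset by blast
  have finr: "finite ([W]\<^bsup>r\<^esup>)" using assms(1) by (simp add: finite_imp_finite_nsets)
  define U where "U = (\<Union>p\<in>B. {e \<in> [W]\<^bsup>r\<^esup>. p \<subseteq> e})"
  have "card U \<le> (\<Sum>p\<in>B. card {e \<in> [W]\<^bsup>r\<^esup>. p \<subseteq> e})"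
    unfolding U_def using finB by (rule card_UN_le)
  also have "\<dots> \<le> (\<Sum>p\<in>B. (card W - s) choose (r - s))"
    using assms by (intro sum_mono card_nsets_containing_le) auto
  finally have "real (card U) \<le> real (card B) * real ((card W - s) choose (r - s))"
    by (simp flip: of_nat_mult)
  also have "\<dots> \<le> \<beta> * real (card W choose s) * real ((card W - s) choose (r - s))"
    using assms(4) by (rule mult_right_mono) simp
  also have "\<dots> = \<beta> * (real (card W choose r) * real (r choose s))"
    using choose_mult[OF assms(3) True] by (simp flip: of_nat_mult)
  finally have U: "real (card U) \<le> \<beta> * (real (card W choose r) * real (r choose s))" .
  have "{e \<in> [W]\<^bsup>r\<^esup>. \<forall>p\<in>B. \<not> p \<subseteq> e} = [W]\<^bsup>r\<^esup> - U" by (auto simp: U_def)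
  moreover have "U \<subseteq> [W]\<^bsup>r\<^esup>" by (auto simp: U_def)
  ultimately have "real (card {e \<in> [W]\<^bsup>r\<^esup>. \<forall>p\<in>B. \<not> p \<subseteq> e}) = real (card W choose r) - real (card U)"
    using finr finite_subset[of U "[W]\<^bsup>r\<^esup>"] card_mono[of "[W]\<^bsup>r\<^esup>" U]
    by (simp add: card_Diff_subset card_nsets of_nat_diff)
  then show ?thesis using U by (simp add: algebra_simps)
next
  case False
  then show ?thesis by (simp add: binomial_eq_0)
qed

section \<open>Geometry of nearly regular simplices\<close>

text \<open>Scalar form of the identity between a squared sum and the pairwise differences. Both
  sides are doubled because the double sum runs over ordered pairs.\<close>

lemma square_sum_eq_differences:
  fixes y :: "'a \<Rightarrow> 'b :: comm_ring_1"
  assumes "finite e"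
  shows "2 * (\<Sum>u\<in>e. y u)\<^sup>2 =
    2 * of_nat (card e) * (\<Sum>u\<in>e. (y u)\<^sup>2) - (\<Sum>u\<in>e. \<Sum>v\<in>e. (y u - y v)\<^sup>2)"
proof -
  have "(\<Sum>u\<in>e. \<Sum>v\<in>e. (y u - y v)\<^sup>2) = (\<Sum>u\<in>e. \<Sum>v\<in>e. (y u)\<^sup>2 + (y v)\<^sup>2 - 2 * (y u * y v))"
    by (simp add: power2_diff algebra_simps)
  also have "\<dots> = 2 * of_nat (card e) * (\<Sum>u\<in>e. (y u)\<^sup>2) - 2 * (\<Sum>u\<in>e. \<Sum>v\<in>e. y u * y v)"
    by (simp add: sum_subtractf sum.distrib flip: sum_distrib_left)
  finally show ?thesis by (simp add: power2_eq_square sum_product)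
qed

text \<open>Real-valued, so that differences of natural coordinates are not truncated.\<close>

definition sqdist :: "nat \<Rightarrow> (nat \<Rightarrow> nat) \<Rightarrow> (nat \<Rightarrow> nat) \<Rightarrow> real" where
  "sqdist m a b = (\<Sum>i<m. (real (a i) - real (b i))\<^sup>2)"

lemma sqdist_self [simp]: "sqdist m a a = 0"
  by (simp add: sqdist_def)

definition near_regular :: "nat \<Rightarrow> real \<Rightarrow> real \<Rightarrow> ('a \<Rightarrow> nat \<Rightarrow> nat) \<Rightarrow> 'a set \<Rightarrow> bool" where
  "near_regular m \<tau> \<eta> x e \<longleftrightarrow> finite e \<and>
    (\<forall>u\<in>e. \<forall>v\<in>e. u \<noteq> v \<longrightarrow> \<bar>sqdist m (x u) (x v) - \<tau>\<bar> \<le> \<eta>)"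

text \<open>The term \<open>v = u\<close> is zero, which leaves \<open>card e - 1\<close> terms,
  each within \<open>\<eta>\<close> of \<open>\<tau>\<close>.\<close>

lemma near_regular_sum_from_vertex:
  assumes "near_regular m \<tau> \<eta> x e" "u \<in> e"
  shows "(\<Sum>v\<in>e. sqdist m (x u) (x v)) \<le> (real (card e) - 1) * (\<tau> + \<eta>)"
    and "(\<Sum>v\<in>e. sqdist m (x u) (x v)) \<ge> (real (card e) - 1) * (\<tau> - \<eta>)"
proof -
  have fin: "finite e" using assms by (simp add: near_regular_def)
  have eq: "(\<Sum>v\<in>e. sqdist m (x u) (x v)) = (\<Sum>v\<in>e - {u}. sqdist m (x u) (x v))"
    using sum.remove[OF fin assms(2), of "\<lambda>v. sqdist m (x u) (x v)"] by simp
  have c: "real (card e) - 1 = real (card (e - {u}))"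
    using arg_cong[OF card_Suc_Diff1[OF fin assms(2)], of real] by (simp only: of_nat_Suc)
  have near: "\<forall>u\<in>e. \<forall>v\<in>e. u \<noteq> v \<longrightarrow> \<bar>sqdist m (x u) (x v) - \<tau>\<bar> \<le> \<eta>"
    using assms(1) unfolding near_regular_def by (rule conjunct2)
  have b: "\<bar>sqdist m (x u) (x v) - \<tau>\<bar> \<le> \<eta>" if "v \<in> e - {u}" for v
    by (rule near[rule_format]) (use assms(2) that in auto)
  have b': "sqdist m (x u) (x v) \<le> \<tau> + \<eta>" "\<tau> - \<eta> \<le> sqdist m (x u) (x v)"
    if "v \<in> e - {u}" for v
    using b[OF that] by (simp_all add: abs_le_iff)
  show "(\<Sum>v\<in>e. sqdist m (x u) (x v)) \<le> (real (card e) - 1) * (\<tau> + \<eta>)"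
    "(\<Sum>v\<in>e. sqdist m (x u) (x v)) \<ge> (real (card e) - 1) * (\<tau> - \<eta>)"
    unfolding eq c by (rule sum_bounded_above[OF b'(1)] sum_bounded_below[OF b'(2)]; assumption)+
qed

lemma near_regular_sum_all:
  assumes "near_regular m \<tau> \<eta> x e"
  shows "(\<Sum>u\<in>e. \<Sum>v\<in>e. sqdist m (x u) (x v)) \<ge> real (card e) * ((real (card e) - 1) * (\<tau> - \<eta>))"
  by (intro sum_bounded_below near_regular_sum_from_vertex(2) assms)

lemma sqnorm_sum_eq:
  fixes y :: "'a \<Rightarrow> nat \<Rightarrow> real"
  assumes "finite e"
  shows "2 * (\<Sum>i<m. (\<Sum>u\<in>e. y u i)\<^sup>2) =
    2 * real (card e) * (\<Sum>u\<in>e. \<Sum>i<m. (y u i)\<^sup>2) - (\<Sum>u\<in>e. \<Sum>v\<in>e. \<Sum>i<m. (y u i - y v i)\<^sup>2)"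
proof -
  have "2 * (\<Sum>i<m. (\<Sum>u\<in>e. y u i)\<^sup>2) = (\<Sum>i<m. 2 * real (card e) * (\<Sum>u\<in>e. (y u i)\<^sup>2)
      - (\<Sum>u\<in>e. \<Sum>v\<in>e. (y u i - y v i)\<^sup>2))"
    by (simp add: sum_distrib_left square_sum_eq_differences[OF assms])
  also have "\<dots> = 2 * real (card e) * (\<Sum>i<m. \<Sum>u\<in>e. (y u i)\<^sup>2)
      - (\<Sum>i<m. \<Sum>u\<in>e. \<Sum>v\<in>e. (y u i - y v i)\<^sup>2)"
    by (simp add: sum_subtractf sum_distrib_left)
  also have "(\<Sum>i<m. \<Sum>u\<in>e. (y u i)\<^sup>2) = (\<Sum>u\<in>e. \<Sum>i<m. (y u i)\<^sup>2)"
    by (rule sum.swap)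
  also have "(\<Sum>i<m. \<Sum>u\<in>e. \<Sum>v\<in>e. (y u i - y v i)\<^sup>2) = (\<Sum>u\<in>e. \<Sum>v\<in>e. \<Sum>i<m. (y u i - y v i)\<^sup>2)"
    by (subst sum.swap, intro sum.cong refl, rule sum.swap)
  finally show ?thesis .
qed

text \<open>The circumradius of a regular simplex, scaled by \<open>r\<close> to avoid division. The
  identity is applied to the vectors from the vertices \<open>u\<close> to \<open>v\<close>, whose
  pairwise differences are those of the simplex; the error \<open>3 * \<eta>\<close> is
  \<open>2 * \<eta>\<close> from the distances to \<open>v\<close> plus \<open>\<eta>\<close> from
  the pairwise ones.\<close>

lemma near_regular_vertex_to_centroid:
  assumes "near_regular m \<tau> \<eta> x e" "v \<in> e" "card e = r"
  shows "2 * (\<Sum>i<m. (real r * real (x v i) - (\<Sum>u\<in>e. real (x u i)))\<^sup>2)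
    \<le> real r * (real r - 1) * (\<tau> + 3 * \<eta>)"
proof -
  have fin: "finite e" using assms by (simp add: near_regular_def)
  have "2 * (\<Sum>i<m. (real r * real (x v i) - (\<Sum>u\<in>e. real (x u i)))\<^sup>2)
      = 2 * (\<Sum>i<m. (\<Sum>u\<in>e. real (x v i) - real (x u i))\<^sup>2)"
    by (simp add: sum_subtractf assms(3))
  also have "\<dots> = 2 * real r * (\<Sum>u\<in>e. sqdist m (x v) (x u)) - (\<Sum>u\<in>e. \<Sum>v\<in>e. sqdist m (x u) (x v))"
  proof -
    have "(real (x v i) - real (x u i) - (real (x v i) - real (x u' i)))\<^sup>2
        = (real (x u i) - real (x u' i))\<^sup>2" for u u' i
      by (simp add: power2_eq_square algebra_simps)
    then show ?thesis unfolding sqnorm_sum_eq[OF fin] sqdist_def assms(3) by simp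
  qed
  also have "\<dots> \<le> 2 * real r * ((real r - 1) * (\<tau> + \<eta>)) - real r * ((real r - 1) * (\<tau> - \<eta>))"
    using near_regular_sum_from_vertex(1)[OF assms(1,2)] near_regular_sum_all[OF assms(1)] assms(3)
    by (intro diff_mono mult_left_mono) auto
  finally show ?thesis by (simp add: algebra_simps)
qed

text \<open>If all vertices of a nearly regular simplex lie within about the circumradius of
  \<open>w / r\<close>, then its centroid must be close to \<open>w / r\<close>. In the identity for
  the vectors \<open>r * x v - w\<close> the main terms in \<open>\<tau>\<close> cancel, so the
  bound depends on \<open>\<eta>\<close> and \<open>r\<close> alone.\<close>

lemma near_regular_sum_close:
  assumes f: "near_regular m \<tau> \<eta> x f" and r: "card f = r" "r > 0"
    and w: "\<And>v. v \<in> f \<Longrightarrow>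
      2 * (\<Sum>i<m. (real r * real (x v i) - w i)\<^sup>2) \<le> real r * (real r - 1) * (\<tau> + 3 * \<eta>)"
  shows "(\<Sum>i<m. ((\<Sum>v\<in>f. real (x v i)) - w i)\<^sup>2) \<le> 2 * real r * (real r - 1) * \<eta>"
proof -
  have fin: "finite f" using f by (simp add: near_regular_def)
  have "2 * (real r)\<^sup>2 * (\<Sum>i<m. ((\<Sum>v\<in>f. real (x v i)) - w i)\<^sup>2)
      = 2 * (\<Sum>i<m. (\<Sum>v\<in>f. real r * real (x v i) - w i)\<^sup>2)"
  proof -
    have "(\<Sum>v\<in>f. real r * real (x v i) - w i)\<^sup>2
        = (real r)\<^sup>2 * ((\<Sum>v\<in>f. real (x v i)) - w i)\<^sup>2" for i
      by (simp add: sum_subtractf r(1) power_mult_distrib flip: sum_distrib_left right_diff_distrib)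
    then show ?thesis by (simp add: sum_distrib_left mult.assoc)
  qed
  also have "\<dots> = real r * (\<Sum>v\<in>f. 2 * (\<Sum>i<m. (real r * real (x v i) - w i)\<^sup>2))
      - (real r)\<^sup>2 * (\<Sum>u\<in>f. \<Sum>v\<in>f. sqdist m (x u) (x v))"
  proof -
    have "(real r * real (x u i) - w i - (real r * real (x v i) - w i))\<^sup>2
        = (real r)\<^sup>2 * (real (x u i) - real (x v i))\<^sup>2" for u v i
      by (simp add: power_mult_distrib flip: right_diff_distrib)
    then show ?thesis
      unfolding sqnorm_sum_eq[OF fin] sqdist_def r(1) by (simp add: mult.left_commute flip: sum_distrib_left)
  qed
  also have "\<dots> \<le> real r * (real r * (real r * (real r - 1) * (\<tau> + 3 * \<eta>)))
      - (real r)\<^sup>2 * (real r * ((real r - 1) * (\<tau> - \<eta>)))"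
  proof -
    have "(\<Sum>v\<in>f. 2 * (\<Sum>i<m. (real r * real (x v i) - w i)\<^sup>2))
        \<le> real (card f) * (real r * (real r - 1) * (\<tau> + 3 * \<eta>))"
      by (rule sum_bounded_above) (rule w)
    then show ?thesis
      using near_regular_sum_all[OF f] unfolding r(1) by (intro diff_mono mult_left_mono) auto
  qed
  also have "\<dots> = 2 * (real r)\<^sup>2 * (2 * real r * (real r - 1) * \<eta>)"
    by (simp add: algebra_simps power2_eq_square)
  finally show ?thesis by (rule mult_left_le_imp_le) (use r(2) in simp)
qed

section \<open>Classes given by vector sum and colour set\<close>

text \<open>Equal sums give the Steiner property, equal colour sets make the classes induced. The
  cardinality bound counts keys: \<open>(r * C) ^ m\<close> vector sums times the
  \<open>r\<close>-sets of colours.\<close>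

lemma induced_steiner_decomposition_exists:
  fixes x :: "'a \<Rightarrow> nat \<Rightarrow> nat" and \<alpha> :: "nat \<Rightarrow> nat" and q :: "'a \<Rightarrow> nat"
  assumes W: "finite W" and r: "r \<ge> 2" and m: "m > 0"
    and inj: "\<And>u v. u \<in> W \<Longrightarrow> v \<in> W \<Longrightarrow> (\<And>i. i < m \<Longrightarrow> x u i = x v i) \<Longrightarrow> u = v"
    and E: "E \<subseteq> [W]\<^bsup>r\<^esup>"
    and regular: "\<And>e. e \<in> E \<Longrightarrow> near_regular m \<tau> \<eta> x e"
    and q_inj: "\<And>e. e \<in> E \<Longrightarrow> inj_on q e"
    and form: "\<And>\<delta>::nat \<Rightarrow> int. real_of_int (\<Sum>i<m. (\<delta> i)\<^sup>2) \<le> 2 * real r * (real r - 1) * \<eta> \<Longrightarrow>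
      \<exists>i<m. \<delta> i \<noteq> 0 \<Longrightarrow> (\<Sum>i<m. int (\<alpha> i) * \<delta> i) \<noteq> 0"
    and x_less: "\<And>u i. u \<in> W \<Longrightarrow> i < m \<Longrightarrow> x u i < C"
    and q_less: "\<And>u. u \<in> W \<Longrightarrow> q u < C"
    and \<alpha>_less: "\<And>i. i < m \<Longrightarrow> \<alpha> i < A"
  shows "\<exists>P. induced_steiner_decomposition (r - 1) r E P \<and>
    card P \<le> (r * C) ^ m * (C * (m * (A * C))) ^ r"
proof -
  \<comment> \<open>\<open>q\<close> only makes the colours distinct within an edge, so that an edge whose colours lie in
    \<open>col ` e\<close> uses each of them exactly once; \<open>h\<close> then detects a deviation of the sum.\<close>
  define h where "h u = (\<Sum>i<m. \<alpha> i * x u i)" for u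
  define col where "col u = (q u, h u)" for u
  \<comment> \<open>Restricting to \<open>{..<m}\<close> makes equality of sums an equality of
    functions and places the sums in a finite \<open>PiE\<close>.\<close>
  define total where "total e = (\<lambda>i\<in>{..<m}. \<Sum>u\<in>e. x u i)" for e
  define key where "key e = (total e, col ` e)" for e
  define cls where "cls \<kappa> = {e \<in> E. key e = \<kappa>}" for \<kappa>
  define P where "P = cls ` key ` E"
  have Ein: "e \<subseteq> W" "finite e" "card e = r" if "e \<in> E" for e
    using E that by (auto simp: nsets_def)
  have col_inj: "inj_on col e" if "e \<in> E" for e
    using q_inj[OF that] by (auto simp: inj_on_def col_def)
  have h_eq: "(\<Sum>u\<in>e. h u) = (\<Sum>c\<in>col ` e. snd c)" if "e \<in> E" for e
    using sum.reindex[OF col_inj[OF that], of snd] by (simp add: col_def)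
  have h_total: "int (\<Sum>u\<in>e. h u) = (\<Sum>i<m. int (\<alpha> i) * int (\<Sum>u\<in>e. x u i))" for e
    unfolding h_def by (subst sum.swap) (simp add: sum_distrib_left)
  have partition: "partition_on E P"
    by (rule partition_onI) (auto simp: P_def cls_def disjnt_def)
  have induced: "K = induced_edges E (\<Union>K)" if K: "K \<in> P" for K
  proof
    show "K \<subseteq> induced_edges E (\<Union>K)"
      using K by (auto simp: P_def cls_def induced_edges_def)
    show "induced_edges E (\<Union>K) \<subseteq> K"
    proof
      fix f assume "f \<in> induced_edges E (\<Union>K)"
      then have f: "f \<in> E" "f \<subseteq> \<Union>K" by (auto simp: induced_edges_def)
      obtain e where e: "e \<in> E" "K = cls (key e)" using K by (auto simp: P_def)
      have sub: "\<exists>e'\<in>E. key e' = key e \<and> v \<in> e'" if "v \<in> f" for v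
        using f(2) e(2) that by (auto simp: cls_def)
      \<comment> \<open>Each vertex of \<open>f\<close> lies in some edge of the class, and all
        these edges have the colours of \<open>e\<close>. Both colour sets have \<open>r\<close>
        elements, so the inclusion is an equality.\<close>
      have "col ` f \<subseteq> col ` e"
        using sub by (fastforce simp: key_def)
      then have cols: "col ` f = col ` e"
        using Ein f(1) e(1) col_inj by (intro card_subset_eq) (auto simp: card_image)
      define \<delta> where "\<delta> i = int (\<Sum>u\<in>f. x u i) - int (\<Sum>u\<in>e. x u i)" for i
      have "(\<Sum>i<m. int (\<alpha> i) * \<delta> i) = int (\<Sum>u\<in>f. h u) - int (\<Sum>u\<in>e. h u)"
        unfolding h_total \<delta>_def by (simp add: right_diff_distrib sum_subtractf)
      also have "\<dots> = 0" using h_eq f(1) e(1) cols by simp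
      finally have zero: "(\<Sum>i<m. int (\<alpha> i) * \<delta> i) = 0" .
      have "(\<Sum>i<m. ((\<Sum>v\<in>f. real (x v i)) - real (\<Sum>u\<in>e. x u i))\<^sup>2) \<le> 2 * real r * (real r - 1) * \<eta>"
      proof (rule near_regular_sum_close[OF regular[OF f(1)] Ein(3)[OF f(1)]])
        \<comment> \<open>The edge \<open>e'\<close> may vary with \<open>v\<close>, but its sum is
          always that of \<open>e\<close>, so all vertices of \<open>f\<close> are at nearly the
          same distance from one common centroid.\<close>
        fix v assume "v \<in> f"
        then obtain e' where e': "e' \<in> E" "key e' = key e" "v \<in> e'" using sub by blast
        have "(\<Sum>u\<in>e'. x u i) = (\<Sum>u\<in>e. x u i)" if "i < m" for i
        proof -
          have "total e' i = total e i" using e'(2) by (simp add: key_def)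
          then show ?thesis using that by (simp add: total_def)
        qed
        then have "(\<Sum>i<m. (real r * real (x v i) - real (\<Sum>u\<in>e. x u i))\<^sup>2)
            = (\<Sum>i<m. (real r * real (x v i) - (\<Sum>u\<in>e'. real (x u i)))\<^sup>2)"
          by (intro sum.cong refl) (simp flip: of_nat_sum)
        then show "2 * (\<Sum>i<m. (real r * real (x v i) - real (\<Sum>u\<in>e. x u i))\<^sup>2)
            \<le> real r * (real r - 1) * (\<tau> + 3 * \<eta>)"
          using near_regular_vertex_to_centroid[OF regular[OF e'(1)] e'(3) Ein(3)[OF e'(1)]] by simp
      qed (use r in auto)
      then have "real_of_int (\<Sum>i<m. (\<delta> i)\<^sup>2) \<le> 2 * real r * (real r - 1) * \<eta>"
        by (simp add: \<delta>_def)
      then have "\<delta> i = 0" if "i < m" for i using form zero that by blast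
      then have "total f = total e"
        by (auto simp: total_def \<delta>_def simp del: of_nat_sum intro!: restrict_ext)
      then show "f \<in> K" using f(1) e cols by (simp add: cls_def key_def)
    qed
  qed
  \<comment> \<open>Two edges of a class sharing \<open>r - 1\<close> vertices have equal sums, so
    their remaining vertices have equal coordinates and coincide by \<open>inj\<close>.\<close>
  have steiner: "partial_steiner_system (r - 1) r (\<Union>K) K" if K: "K \<in> P" for K
  proof -
    have KE: "K \<subseteq> E" using K by (auto simp: P_def cls_def)
    have "\<Union>K \<subseteq> W" using KE Ein(1) by blast
    then have "finite (\<Union>K)" using W finite_subset by blast
    moreover have "K \<subseteq> [\<Union>K]\<^bsup>r\<^esup>" using KE Ein by (auto simp: nsets_def)
    moreover have "e = e'"
      if T: "T \<in> nsets (\<Union>K) (r - 1)" and e: "e \<in> K" "T \<subseteq> e" and e': "e' \<in> K" "T \<subseteq> e'" for T e e'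
    proof -
      have tot: "total e = total e'" using K e(1) e'(1) by (auto simp: P_def cls_def key_def)
      have T': "finite T" "card T = r - 1" using T by (auto simp: nsets_def)
      have ext: "\<exists>a. a \<notin> T \<and> d = insert a T \<and> a \<in> W" if "d \<in> E" "T \<subseteq> d" for d
      proof -
        have "card (d - T) = 1" using Ein[OF that(1)] T' that(2) r by (simp add: card_Diff_subset)
        then obtain a where a: "d - T = {a}" using card_1_singletonE by blast
        then have "d = insert a T" "a \<in> d" "a \<notin> T" using that(2) by auto
        then show ?thesis using Ein(1)[OF that(1)] by auto
      qed
      have eE: "e \<in> E" "e' \<in> E" using e(1) e'(1) KE by auto
      obtain a where a: "a \<notin> T" "e = insert a T" "a \<in> W" using ext[OF eE(1) e(2)] by blast
      obtain b where b: "b \<notin> T" "e' = insert b T" "b \<in> W" using ext[OF eE(2) e'(2)] by blast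
      have "x a i = x b i" if "i < m" for i
        using fun_cong[OF tot, of i] that a b T' by (simp add: total_def)
      then have "a = b" using inj a b by blast
      then show ?thesis using a b by simp
    qed
    ultimately show ?thesis
      unfolding partial_steiner_system_def uniform_hypergraph_def by (auto intro!: Uniq_I)
  qed
  have "card P \<le> (r * C) ^ m * (C * (m * (A * C))) ^ r"
  proof -
    \<comment> \<open>The second factor bounds \<open>h\<close>, a sum of \<open>m\<close> terms
      below \<open>A * C\<close>.\<close>
    define Q where "Q = {..<C} \<times> {..<m * (A * C)}"
    have finQ: "finite Q" "card Q = C * (m * (A * C))" by (auto simp: Q_def)
    have finK: "finite (PiE {..<m} (\<lambda>_. {..<r * C}) \<times> [Q]\<^bsup>r\<^esup>)"
      using finQ by (intro finite_cartesian_product finite_PiE finite_imp_finite_nsets) auto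
    have colQ: "col u \<in> Q" if "u \<in> W" for u
    proof -
      have "h u < (\<Sum>i<m. A * C)"
        unfolding h_def
      proof (rule sum_strict_mono)
        fix i assume "i \<in> {..<m}"
        then show "\<alpha> i * x u i < A * C"
          using x_less[OF that, of i] \<alpha>_less[of i] by (intro mult_strict_mono) auto
      qed (use m in auto)
      then show ?thesis using q_less[OF that] by (simp add: col_def Q_def)
    qed
    have "key ` E \<subseteq> PiE {..<m} (\<lambda>_. {..<r * C}) \<times> [Q]\<^bsup>r\<^esup>"
    proof
      fix \<kappa> assume "\<kappa> \<in> key ` E"
      then obtain e where e: "e \<in> E" "\<kappa> = key e" by blast
      have "(\<Sum>u\<in>e. x u i) < r * C" if "i < m" for i
      proof -
        have "(\<Sum>u\<in>e. x u i) < (\<Sum>u\<in>e. C)"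
          using Ein[OF e(1)] r that x_less by (intro sum_strict_mono) auto
        then show ?thesis using Ein[OF e(1)] by simp
      qed
      then have "total e \<in> PiE {..<m} (\<lambda>_. {..<r * C})" by (auto simp: total_def)
      moreover have "col ` e \<in> [Q]\<^bsup>r\<^esup>"
        using Ein[OF e(1)] colQ col_inj[OF e(1)] by (auto simp: nsets_def card_image)
      ultimately show "\<kappa> \<in> PiE {..<m} (\<lambda>_. {..<r * C}) \<times> [Q]\<^bsup>r\<^esup>"
        by (simp add: e(2) key_def)
    qed
    then have "card (key ` E) \<le> card (PiE {..<m} (\<lambda>_. {..<r * C}) \<times> [Q]\<^bsup>r\<^esup>)"
      by (intro card_mono finK)
    also have "\<dots> = (r * C) ^ m * (card Q choose r)"
      by (simp add: card_cartesian_product card_PiE card_nsets)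
    also have "\<dots> \<le> (r * C) ^ m * card Q ^ r"
      by (cases "r \<le> card Q") (auto simp: binomial_le_pow binomial_eq_0 intro!: mult_le_mono2)
    finally have "card (key ` E) \<le> (r * C) ^ m * (C * (m * (A * C))) ^ r" by (simp add: finQ)
    moreover have "finite (key ` E)"
      using E W finite_imp_finite_nsets finite_subset by blast
    then have "card P \<le> card (key ` E)" unfolding P_def by (rule card_image_le)
    ultimately show ?thesis by linarith
  qed
  then show ?thesis
    using partition induced steiner unfolding induced_steiner_decomposition_def by blast
qed

section \<open>Bad pairs, short vectors and the resulting hypergraph\<close>

text \<open>Once \<open>u\<close> is fixed, the last digit of \<open>v\<close> is forced and the
  other \<open>m - 1\<close> digits are free.\<close>

lemma card_same_residue_le:
  assumes "C > 0" "m > 0"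
  shows "real (card {(u, v). u < C ^ m \<and> v < C ^ m \<and> u mod C = v mod C}) \<le> (real (C ^ m))\<^sup>2 / real C"
proof -
  obtain k where k: "m = Suc k" using assms(2) gr0_implies_Suc by blast
  have le: "card {v. v < C ^ m \<and> u mod C = v mod C} \<le> C ^ k" for u
  proof -
    have "card {v. v < C ^ m \<and> u mod C = v mod C} \<le> card {..<C ^ k}"
    proof (rule card_inj_on_le)
      show "inj_on (\<lambda>v. v div C) {v. v < C ^ m \<and> u mod C = v mod C}"
        by (auto simp: inj_on_def) (metis div_mult_mod_eq)
      show "(\<lambda>v. v div C) ` {v. v < C ^ m \<and> u mod C = v mod C} \<subseteq> {..<C ^ k}"
        using k by (auto simp: less_mult_imp_div_less mult.commute)
    qed simp
    then show ?thesis by simp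
  qed
  have "{(u, v). u < C ^ m \<and> v < C ^ m \<and> u mod C = v mod C}
      = (SIGMA u:{..<C ^ m}. {v. v < C ^ m \<and> u mod C = v mod C})"
    by auto
  then have "card {(u, v). u < C ^ m \<and> v < C ^ m \<and> u mod C = v mod C}
      = (\<Sum>u<C ^ m. card {v. v < C ^ m \<and> u mod C = v mod C})"
    by simp
  also have "\<dots> \<le> (\<Sum>u<C ^ m. C ^ k)" by (intro sum_mono le)
  finally have "real (card {(u, v). u < C ^ m \<and> v < C ^ m \<and> u mod C = v mod C}) \<le> real (C ^ m * C ^ k)"
    by (simp only: of_nat_le_iff) simp
  also have "\<dots> = (real (C ^ m))\<^sup>2 / real C"
    using assms(1) by (simp add: k power2_eq_square)
  finally show ?thesis .
qed

text \<open>Chebyshev's inequality with \<open>\<tau> = m * \<sigma>\<close>, where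
  \<open>\<sigma>\<close> is the mean squared difference of two random digits. The second moment is
  at most \<open>m * C ^ 4\<close> on average, and the deviation threshold is
  \<open>m\<close>.\<close>

lemma exists_typical_distance:
  assumes C: "C > 0" and m: "m > 0"
  shows "\<exists>\<tau>. real (card {(u, v). u < C ^ m \<and> v < C ^ m \<and>
      real m < \<bar>sqdist m (digit C u) (digit C v) - \<tau>\<bar>}) \<le> real C ^ 4 / real m * (real (C ^ m))\<^sup>2"
proof -
  define \<sigma> where "\<sigma> = (\<Sum>a<C. \<Sum>b<C. (real a - real b)\<^sup>2) / (real C)\<^sup>2"
  define g where "g a b = (real a - real b)\<^sup>2 - \<sigma>" for a b
  define S where "S = {(u, v). u < C ^ m \<and> v < C ^ m \<and>
      real m < \<bar>sqdist m (digit C u) (digit C v) - real m * \<sigma>\<bar>}"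
  have sq_le: "(real a - real b)\<^sup>2 \<le> (real C)\<^sup>2" if "a < C" "b < C" for a b
    using that by (intro power2_le_iff_abs_le[THEN iffD2]) auto
  have \<sigma>_le: "\<sigma> \<le> (real C)\<^sup>2"
  proof -
    have "(\<Sum>a<C. \<Sum>b<C. (real a - real b)\<^sup>2) \<le> (\<Sum>a<C. \<Sum>b<C. (real C)\<^sup>2)"
      by (intro sum_mono sq_le) auto
    then show ?thesis using C by (simp add: \<sigma>_def field_simps power2_eq_square)
  qed
  have \<sigma>_nonneg: "0 \<le> \<sigma>" by (auto simp: \<sigma>_def intro!: divide_nonneg_nonneg sum_nonneg)
  have mean: "(\<Sum>a<C. \<Sum>b<C. g a b) = 0"
    using C by (simp add: g_def \<sigma>_def sum_subtractf power2_eq_square)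
  have bound: "\<bar>g a b\<bar> \<le> (real C)\<^sup>2" if "a < C" "b < C" for a b
  proof -
    have "0 \<le> (real a - real b)\<^sup>2" by simp
    then show ?thesis unfolding g_def using sq_le[OF that] \<sigma>_le \<sigma>_nonneg by linarith
  qed
  have dev: "sqdist m (digit C u) (digit C v) - real m * \<sigma> = (\<Sum>i<m. g (digit C u i) (digit C v i))" for u v
    by (simp add: sqdist_def g_def sum_subtractf)
  have finS: "finite S"
    by (rule finite_subset[of _ "{..<C ^ m} \<times> {..<C ^ m}"]) (auto simp: S_def)
  have "real (card S) * (real m)\<^sup>2 = (\<Sum>(u, v)\<in>S. (real m)\<^sup>2)" by simp
  also have "\<dots> \<le> (\<Sum>(u, v)\<in>S. (\<Sum>i<m. g (digit C u i) (digit C v i))\<^sup>2)"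
  proof (rule sum_mono, clarify)
    fix u v assume "(u, v) \<in> S"
    then have "\<bar>real m\<bar> \<le> \<bar>\<Sum>i<m. g (digit C u i) (digit C v i)\<bar>"
      unfolding dev[symmetric] by (simp add: S_def)
    then show "(real m)\<^sup>2 \<le> (\<Sum>i<m. g (digit C u i) (digit C v i))\<^sup>2"
      by (simp only: abs_le_square_iff)
  qed
  also have "\<dots> \<le> (\<Sum>(u, v)\<in>{..<C ^ m} \<times> {..<C ^ m}. (\<Sum>i<m. g (digit C u i) (digit C v i))\<^sup>2)"
    by (rule sum_mono2) (auto simp: S_def)
  also have "\<dots> = (\<Sum>u<C ^ m. \<Sum>v<C ^ m. (\<Sum>i<m. g (digit C u i) (digit C v i))\<^sup>2)"
    by (simp add: sum.cartesian_product)
  also have "\<dots> \<le> real m * ((real C)\<^sup>2)\<^sup>2 * (real (C ^ m))\<^sup>2"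
    by (rule digit_second_moment[OF C mean bound])
  finally have "(real m)\<^sup>2 * real (card S) \<le> (real m)\<^sup>2 * (real C ^ 4 / real m * (real (C ^ m))\<^sup>2)"
    using m by (simp add: power2_eq_square power4_eq_xxxx mult.assoc mult.left_commute mult.commute)
  then have "real (card S) \<le> real C ^ 4 / real m * (real (C ^ m))\<^sup>2"
    by (rule mult_left_le_imp_le) (use m in simp)
  then show ?thesis unfolding S_def by blast
qed

text \<open>Integers satisfy \<open>\<bar>z\<bar> \<le> z\<^sup>2\<close>, so a Euclidean bound on
  the squared length is also an l1 bound and the count of the l1 ball applies.\<close>

lemma exists_short_vector_hash:
  fixes m s :: nat
  shows "\<exists>\<alpha>::nat \<Rightarrow> nat. (\<forall>i. \<alpha> i < 3 ^ m * 2 ^ s + 1) \<and>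
    (\<forall>\<delta>::nat \<Rightarrow> int. (\<Sum>i<m. (\<delta> i)\<^sup>2) \<le> int s \<longrightarrow> (\<exists>i<m. \<delta> i \<noteq> 0) \<longrightarrow>
      (\<Sum>i<m. int (\<alpha> i) * \<delta> i) \<noteq> 0)"
proof -
  define B where "B = {\<delta> \<in> PiE {..<m} (\<lambda>_. {- int s..int s}). (\<Sum>i<m. \<bar>\<delta> i\<bar>) \<le> int s}"
  have "finite B" unfolding B_def by (intro finite_Collect_conjI disjI1 finite_PiE) (auto simp: finite_PiE)
  moreover have "card B < 3 ^ m * 2 ^ s + 1"
    using card_l1_ball_le[of m s] by (simp add: B_def)
  ultimately obtain \<alpha> :: "nat \<Rightarrow> nat" where \<alpha>: "\<And>i. \<alpha> i < 3 ^ m * 2 ^ s + 1"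
    "\<And>\<delta>. \<delta> \<in> B \<Longrightarrow> \<exists>i<m. \<delta> i \<noteq> 0 \<Longrightarrow> (\<Sum>i<m. int (\<alpha> i) * \<delta> i) \<noteq> 0"
    using exists_nonvanishing_linear_form[of B "3 ^ m * 2 ^ s + 1" m] by blast
  have "(\<Sum>i<m. int (\<alpha> i) * \<delta> i) \<noteq> 0"
    if \<delta>: "(\<Sum>i<m. (\<delta> i)\<^sup>2) \<le> int s" "\<exists>i<m. \<delta> i \<noteq> 0" for \<delta> :: "nat \<Rightarrow> int"
  proof -
    have abs_le: "\<bar>z\<bar> \<le> z\<^sup>2" for z :: int
    proof (cases "z = 0")
      case False
      then show ?thesis
        using mult_right_mono[of 1 "\<bar>z\<bar>" "\<bar>z\<bar>"] by (simp add: power2_eq_square)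
    qed simp
    have l1: "(\<Sum>i<m. \<bar>\<delta> i\<bar>) \<le> int s"
      using sum_mono[of "{..<m}" "\<lambda>i. \<bar>\<delta> i\<bar>" "\<lambda>i. (\<delta> i)\<^sup>2"] abs_le \<delta>(1) by fastforce
    have "\<bar>\<delta> i\<bar> \<le> int s" if "i < m" for i
      using member_le_sum[of i "{..<m}" "\<lambda>i. \<bar>\<delta> i\<bar>"] that l1 by simp
    then have "restrict \<delta> {..<m} \<in> B" using l1 by (force simp: B_def abs_le_iff)
    moreover have "\<exists>i<m. restrict \<delta> {..<m} i \<noteq> 0" using \<delta>(2) by auto
    ultimately have "(\<Sum>i<m. int (\<alpha> i) * restrict \<delta> {..<m} i) \<noteq> 0" by (rule \<alpha>(2))
    then show ?thesis by simp
  qed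
  then show ?thesis using \<alpha>(1) by blast
qed

lemma exists_decomposable_hypergraph:
  assumes r: "r \<ge> 2" and m: "m > 0" and C: "C \<ge> 2" and N: "N \<le> C ^ m"
  shows "\<exists>(V::nat set) E P. uniform_hypergraph r V E \<and> card V = N \<and>
    real (card E) \<ge> (1 - 4 * (real C ^ 4 / real m + 1 / real C) * real (r choose 2)) * real (N choose r) \<and>
    induced_steiner_decomposition (r - 1) r E P \<and>
    card P \<le> (r * C) ^ m * (C * (m * ((3 ^ m * 2 ^ (2 * r * (r - 1) * m) + 1) * C))) ^ r"
proof -
  define M where "M = C ^ m"
  \<comment> \<open>The bound of \<open>near_regular_sum_close\<close> for the tolerance
    \<open>\<eta> = m\<close>.\<close>
  define s where "s = 2 * r * (r - 1) * m"
  define \<beta> where "\<beta> = real C ^ 4 / real m + 1 / real C"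
  have "C ^ 1 \<le> C ^ m" using C m by (intro power_increasing) auto
  then have M2: "M \<ge> 2" using C by (simp add: M_def)
  obtain \<tau> where \<tau>: "real (card {(u, v). u < M \<and> v < M \<and>
      real m < \<bar>sqdist m (digit C u) (digit C v) - \<tau>\<bar>}) \<le> real C ^ 4 / real m * (real M)\<^sup>2"
    using exists_typical_distance[of C m] C m by (auto simp: M_def)
  obtain \<alpha> :: "nat \<Rightarrow> nat" where \<alpha>: "\<And>i. \<alpha> i < 3 ^ m * 2 ^ s + 1"
    "\<And>\<delta>::nat \<Rightarrow> int. (\<Sum>i<m. (\<delta> i)\<^sup>2) \<le> int s \<Longrightarrow> \<exists>i<m. \<delta> i \<noteq> 0 \<Longrightarrow>
      (\<Sum>i<m. int (\<alpha> i) * \<delta> i) \<noteq> 0"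
    using exists_short_vector_hash[of m s] by blast
  define far where "far = {(u, v). u < M \<and> v < M \<and> real m < \<bar>sqdist m (digit C u) (digit C v) - \<tau>\<bar>}"
  define same where "same = {(u, v). u < M \<and> v < M \<and> u mod C = v mod C}"
  \<comment> \<open>Diagonal pairs lie in \<open>same\<close> but form no 2-set, so they drop out
    here. Excluding equal last digits makes the last digit usable as \<open>q\<close>.\<close>
  define B where "B = {p \<in> [{..<M}]\<^bsup>2\<^esup>. \<exists>(u, v)\<in>far \<union> same. p = {u, v}}"
  have fin: "finite far" "finite same"
    by (rule finite_subset[of _ "{..<M} \<times> {..<M}"]; auto simp: far_def same_def)+
  have "B \<subseteq> (\<lambda>(u, v). {u, v}) ` (far \<union> same)" by (auto simp: B_def)
  then have "card B \<le> card (far \<union> same)"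
    using fin by (meson card_image_le card_mono finite_UnI finite_imageI le_trans)
  also have "\<dots> \<le> card far + card same" by (rule card_Un_le)
  finally have "real (card B) \<le> real (card far) + real (card same)" by linarith
  also have "\<dots> \<le> real C ^ 4 / real m * (real M)\<^sup>2 + (real M)\<^sup>2 / real C"
    using \<tau> card_same_residue_le[of C m] C m by (intro add_mono) (auto simp: far_def same_def M_def)
  also have "\<dots> = \<beta> * (real M)\<^sup>2" by (simp add: \<beta>_def algebra_simps)
  also have "\<dots> \<le> \<beta> * (4 * real (M choose 2))"
  proof (rule mult_left_mono)
    \<comment> \<open>The constant 4 compares all ordered pairs with the 2-sets; it needs
      \<open>M \<ge> 2\<close>.\<close>
    have "M * M \<le> 2 * (M * (M - 1))"
      using mult_le_mono2[of M "2 * (M - 1)" M] M2 by simp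
    also have "\<dots> = 4 * (M choose 2)" using times_binomial_minus1_eq[of 2 M] by simp
    finally have "real (M * M) \<le> real (4 * (M choose 2))" by (simp only: of_nat_le_iff)
    then show "(real M)\<^sup>2 \<le> 4 * real (M choose 2)" by (simp add: power2_eq_square)
  qed (simp add: \<beta>_def)
  finally have cardB: "real (card B) \<le> 4 * \<beta> * real (M choose 2)" by simp
  \<comment> \<open>Thinning to exactly \<open>N\<close> vertices without raising the density of bad
    pairs.\<close>
  obtain W where W: "W \<subseteq> {..<M}" "card W = N"
    "card (B \<inter> [W]\<^bsup>2\<^esup>) * (M choose 2) \<le> card B * (N choose 2)"
    using exists_sparse_subset[of "{..<M}" B 2 N] N by (auto simp: M_def B_def)
  have finW: "finite W" using W(1) finite_subset by blast
  have "real (card (B \<inter> [W]\<^bsup>2\<^esup>)) * real (M choose 2) \<le> real (card B) * real (N choose 2)"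
    using W(3) by (simp flip: of_nat_mult)
  also have "\<dots> \<le> 4 * \<beta> * real (M choose 2) * real (N choose 2)"
    using cardB by (rule mult_right_mono) simp
  finally have "real (M choose 2) * real (card (B \<inter> [W]\<^bsup>2\<^esup>)) \<le> real (M choose 2) * (4 * \<beta> * real (N choose 2))"
    by (simp add: mult_ac)
  then have sparse: "real (card (B \<inter> [W]\<^bsup>2\<^esup>)) \<le> 4 * \<beta> * real (card W choose 2)"
    unfolding W(2) by (rule mult_left_le_imp_le) (use M2 in simp)
  define E where "E = {e \<in> [W]\<^bsup>r\<^esup>. \<forall>p\<in>B \<inter> [W]\<^bsup>2\<^esup>. \<not> p \<subseteq> e}"
  have dense: "real (card E) \<ge> (1 - 4 * \<beta> * real (r choose 2)) * real (N choose r)"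
    using card_nsets_avoiding_ge[OF finW _ r sparse] by (simp add: E_def W(2))
  have good: "(u, v) \<notin> far" "(u, v) \<notin> same" "u < M" "v < M"
    if "e \<in> E" "u \<in> e" "v \<in> e" "u \<noteq> v" for e u v
  proof -
    have e: "e \<subseteq> W" using that(1) by (auto simp: E_def nsets_def)
    then have pair: "{u, v} \<in> [W]\<^bsup>2\<^esup>" "{u, v} \<in> [{..<M}]\<^bsup>2\<^esup>" "{u, v} \<subseteq> e"
      using that W(1) by auto
    have "\<forall>p\<in>B \<inter> [W]\<^bsup>2\<^esup>. \<not> p \<subseteq> e" using that(1) unfolding E_def by blast
    then have "{u, v} \<notin> B" using pair(1,3) by blast
    then have "\<not> (\<exists>(a, b)\<in>far \<union> same. {u, v} = {a, b})" using pair(2) unfolding B_def by blast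
    then show "(u, v) \<notin> far" "(u, v) \<notin> same" by blast+
    show "u < M" "v < M" using e that W(1) by auto
  qed
  have "\<exists>P. induced_steiner_decomposition (r - 1) r E P \<and>
      card P \<le> (r * C) ^ m * (C * (m * ((3 ^ m * 2 ^ s + 1) * C))) ^ r"
  proof (rule induced_steiner_decomposition_exists[where x = "digit C" and q = "\<lambda>v. v mod C"
        and W = W and \<tau> = \<tau> and \<eta> = "real m" and \<alpha> = \<alpha>])
    show "u = v" if "u \<in> W" "v \<in> W" "\<And>i. i < m \<Longrightarrow> digit C u i = digit C v i" for u v
      using that W(1) by (intro digit_inject[of u C m v]) (auto simp: M_def)
    show "E \<subseteq> [W]\<^bsup>r\<^esup>" by (auto simp: E_def)
    show "near_regular m \<tau> (real m) (digit C) e" if "e \<in> E" for e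
      unfolding near_regular_def
    proof (intro conjI ballI impI)
      show "finite e" using that by (auto simp: E_def nsets_def)
      show "\<bar>sqdist m (digit C u) (digit C v) - \<tau>\<bar> \<le> real m" if "u \<in> e" "v \<in> e" "u \<noteq> v" for u v
        using good[OF \<open>e \<in> E\<close> that] by (auto simp: far_def)
    qed
    show "inj_on (\<lambda>v. v mod C) e" if "e \<in> E" for e
    proof (rule inj_onI, rule ccontr)
      fix u v assume "u \<in> e" "v \<in> e" "u mod C = v mod C" "u \<noteq> v"
      then show False using good[OF that, of u v] by (auto simp: same_def)
    qed
    show "(\<Sum>i<m. int (\<alpha> i) * \<delta> i) \<noteq> 0"
      if "real_of_int (\<Sum>i<m. (\<delta> i)\<^sup>2) \<le> 2 * real r * (real r - 1) * real m" "\<exists>i<m. \<delta> i \<noteq> 0" for \<delta>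
    proof (rule \<alpha>(2)[OF _ that(2)])
      have "2 * real r * (real r - 1) * real m = real_of_int (int s)"
        using r by (simp add: s_def of_nat_diff)
      then show "(\<Sum>i<m. (\<delta> i)\<^sup>2) \<le> int s" using that(1) by (simp only: of_int_le_iff)
    qed
  qed (use finW r m C \<alpha>(1) in \<open>auto simp: digit_less\<close>)
  then obtain P where P: "induced_steiner_decomposition (r - 1) r E P"
    "card P \<le> (r * C) ^ m * (C * (m * ((3 ^ m * 2 ^ s + 1) * C))) ^ r"
    by blast
  have "uniform_hypergraph r W E" using finW by (auto simp: uniform_hypergraph_def E_def)
  then show ?thesis using W(2) dense P unfolding \<beta>_def s_def by blast
qed

section \<open>Choice of parameters and asymptotics\<close>

text \<open>\<open>C\<close> is about \<open>L powr (1 / 10)\<close> and \<open>m\<close> the least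
  dimension with \<open>C ^ m \<ge> N\<close>. The small exponent keeps \<open>C ^ 5 / L\<close>
  small, and \<open>ln C\<close> is still of order \<open>ln L\<close>.\<close>

lemma exists_base_and_dimension:
  fixes N :: nat
  defines "L \<equiv> ln (real N)"
  assumes L: "L \<ge> 2 ^ 20"
  shows "\<exists>C m. C \<ge> 2 \<and> m > 0 \<and> C \<le> m \<and> N \<le> C ^ m \<and> C ^ m \<le> N * C \<and>
    real m \<le> 21 * L / ln L \<and>
    real C ^ 4 / real m + 1 / real C \<le> L powr (- (1 / 2)) + 2 * L powr (- (1 / 10))"
proof -
  define y where "y = L powr (1 / 10)"
  define C where "C = nat \<lfloor>y\<rfloor>"
  define m where "m = nat \<lceil>L / ln (real C)\<rceil>"
  have Lpos: "L > 1" using L by simp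
  have Npos: "N > 0" using Lpos by (cases "N = 0") (auto simp: L_def)
  have y10: "y ^ 10 = L" using Lpos by (simp add: y_def powr_power)
  \<comment> \<open>The threshold \<open>2 ^ 20\<close> is \<open>4 ^ 10\<close>. With
    \<open>y \<ge> 4\<close>, rounding down loses at most a factor 2.\<close>
  have "(4::real) ^ 10 \<le> y ^ 10" unfolding y10 using L by simp
  then have y4: "y \<ge> 4" by (rule power_le_imp_le_base[where n = 9, simplified]) (simp_all add: y_def)
  have Cy: "real C \<le> y" "y - 1 \<le> real C" using y4 by (auto simp: C_def)
  then have C2: "C \<ge> 2" and Chalf: "y / 2 \<le> real C" using y4 by linarith+
  have lnC: "ln (real C) > 0" "ln (real C) \<le> real C" using C2 ln_le_minus_one[of "real C"] by auto
  have lnL: "ln L \<ge> 20 * ln 2"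
  proof -
    have "20 * ln 2 = ln ((2::real) ^ 20)" by (subst ln_realpow) simp_all
    also have "\<dots> \<le> ln L" using L Lpos by (subst ln_le_cancel_iff) auto
    finally show ?thesis .
  qed
  have lnLpos: "ln L > 0" using Lpos by simp
  \<comment> \<open>The loss \<open>ln 2\<close> from rounding is absorbed because
    \<open>ln L \<ge> 20 * ln 2\<close>.\<close>
  have lnC_ge: "ln L / 20 \<le> ln (real C)"
  proof -
    have "ln L / 20 \<le> ln L / 10 - ln 2" using lnL by simp
    also have "\<dots> = ln (y / 2)" using Lpos y4 by (simp add: ln_div y_def ln_powr)
    also have "\<dots> \<le> ln (real C)" using Chalf y4 by (subst ln_le_cancel_iff) auto
    finally show ?thesis .
  qed
  have quot_pos: "0 < L / ln (real C)" using lnC(1) Lpos by simp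
  have m_ge: "L / ln (real C) \<le> real m" and m_le: "real m \<le> L / ln (real C) + 1"
    using quot_pos by (auto simp: m_def)
  have mpos: "m > 0" using m_ge quot_pos by linarith
  \<comment> \<open>The constant is 20 from \<open>lnC_ge\<close> plus 1 for the ceiling.\<close>
  have m_upper: "real m \<le> 21 * L / ln L"
  proof -
    have "L / ln (real C) \<le> L / (ln L / 20)"
      using lnLpos Lpos by (intro divide_left_mono lnC_ge mult_pos_pos lnC(1)) auto
    moreover have "1 \<le> L / ln L" using lnLpos ln_le_minus_one[of L] Lpos by (simp add: field_simps)
    ultimately have "real m \<le> L / (ln L / 20) + L / ln L" using m_le by linarith
    then show ?thesis by (simp flip: add_divide_distrib)
  qed
  have C10: "real C ^ 10 \<le> L" unfolding y10[symmetric] using Cy(1) by (intro power_mono) auto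
  have m_lower: "L / real C \<le> real m"
    by (rule order_trans[OF divide_left_mono[OF lnC(2) _ mult_pos_pos[OF _ lnC(1)]] m_ge])
      (use Lpos C2 in auto)
  have "real C * real C \<le> real C ^ 10"
    using power_increasing[of 2 10 "real C"] C2 by (simp add: power2_eq_square)
  then have "real C \<le> L / real C" using C10 C2 by (simp add: field_simps)
  then have Cm: "C \<le> m" using m_lower by linarith
  have exp_eq: "real (C ^ m) = exp (real m * ln (real C))" using C2 by (simp add: exp_of_nat_mult)
  have expL: "real N = exp L" using Npos by (simp add: L_def)
  have "L \<le> real m * ln (real C)" using m_ge lnC(1) by (simp add: field_simps)
  then have "real N \<le> real (C ^ m)" unfolding exp_eq expL by simp
  then have NC: "N \<le> C ^ m" by (simp only: of_nat_le_iff)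
  \<comment> \<open>Rounding \<open>m\<close> up costs at most one extra factor
    \<open>C\<close>.\<close>
  have "real m * ln (real C) \<le> L + ln (real C)" using m_le lnC(1) by (simp add: field_simps)
  then have "real (C ^ m) \<le> exp (L + ln (real C))" unfolding exp_eq by simp
  also have "\<dots> = real (N * C)" using C2 by (simp add: exp_add expL)
  finally have CN: "C ^ m \<le> N * C" by (simp only: of_nat_le_iff)
  have "real C ^ 4 / real m \<le> real C ^ 4 / (L / real C)"
    using m_lower C2 Lpos mpos by (intro divide_left_mono) auto
  also have "\<dots> = real C ^ 5 / L" by (simp add: eval_nat_numeral)
  also have "\<dots> \<le> y ^ 5 / L" using Cy(1) Lpos by (intro divide_right_mono power_mono) auto
  also have "\<dots> = L powr (- (1 / 2))"
    using Lpos by (simp add: y_def powr_power powr_minus_divide powr_half_sqrt real_div_sqrt field_simps)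
  finally have "real C ^ 4 / real m \<le> L powr (- (1 / 2))" .
  moreover have "1 / real C \<le> 2 * L powr (- (1 / 10))"
  proof -
    have "1 / real C \<le> 1 / (y / 2)"
      by (rule divide_left_mono[OF Chalf _ mult_pos_pos]) (use y4 C2 in auto)
    then show ?thesis by (simp add: y_def powr_minus_divide)
  qed
  ultimately show ?thesis using C2 mpos Cm NC CN m_upper by (intro exI[of _ C] exI[of _ m]) auto
qed

text \<open>Apart from \<open>C ^ m \<le> N * C\<close>, every factor is exponential in
  \<open>m\<close>, because \<open>C \<le> m \<le> 2 ^ m\<close>. In \<open>Q\<close>, the 6 is 3
  times a 2 absorbing the summand 1; in \<open>D\<close>, the 8 pays for \<open>m\<close> and two
  factors \<open>C\<close>, and the 2 for the \<open>C\<close> in \<open>N * C\<close>.\<close>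

lemma exists_class_count_base:
  fixes r :: nat
  assumes "r > 0"
  shows "\<exists>D::nat. D \<ge> 2 \<and> (\<forall>C m N. C \<le> m \<longrightarrow> C ^ m \<le> N * C \<longrightarrow>
    (r * C) ^ m * (C * (m * ((3 ^ m * 2 ^ (2 * r * (r - 1) * m) + 1) * C))) ^ r \<le> N * D ^ m)"
proof -
  define Q :: nat where "Q = 6 * 2 ^ (2 * r * (r - 1))"
  define D where "D = 2 * r * (8 * Q) ^ r"
  have "(r * C) ^ m * (C * (m * ((3 ^ m * 2 ^ (2 * r * (r - 1) * m) + 1) * C))) ^ r \<le> N * D ^ m"
    if Cm: "C \<le> m" and CN: "C ^ m \<le> N * C" for C m N
  proof (cases "m = 0")
    \<comment> \<open>This case is contradictory: \<open>C = 0\<close>, and \<open>C ^ 0 = 1\<close>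
      exceeds \<open>N * C\<close>.\<close>
    case True
    then show ?thesis using Cm CN assms by simp
  next
    case False
    have m2: "m \<le> 2 ^ m" using less_exp[of m] by simp
    then have C2: "C \<le> 2 ^ m" using Cm by (rule le_trans[rotated])
    have "3 ^ m * 2 ^ (2 * r * (r - 1) * m) + 1 \<le> 2 * (3 ^ m * 2 ^ (2 * r * (r - 1) * m) :: nat)"
      by (simp add: Suc_le_eq)
    also have "\<dots> \<le> 2 ^ m * (3 ^ m * 2 ^ (2 * r * (r - 1) * m))"
      using False by (intro mult_le_mono1) (simp add: self_le_power)
    also have "\<dots> = Q ^ m"
      by (simp add: Q_def power_mult_distrib power_mult flip: power_mult_distrib[of 2 3])
    finally have A: "3 ^ m * 2 ^ (2 * r * (r - 1) * m) + 1 \<le> Q ^ m" .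
    have "C * (m * ((3 ^ m * 2 ^ (2 * r * (r - 1) * m) + 1) * C)) \<le> 2 ^ m * (2 ^ m * (Q ^ m * 2 ^ m))"
      by (intro mult_le_mono C2 m2 A)
    also have "\<dots> = (8 * Q) ^ m"
    proof -
      have "(8::nat) ^ m = 2 ^ m * 2 ^ m * 2 ^ m" by (simp flip: power_mult_distrib)
      then show ?thesis by (simp add: power_mult_distrib)
    qed
    finally have "(C * (m * ((3 ^ m * 2 ^ (2 * r * (r - 1) * m) + 1) * C))) ^ r \<le> ((8 * Q) ^ m) ^ r"
      by (rule power_mono) simp
    moreover have "(r * C) ^ m \<le> r ^ m * (N * 2 ^ m)"
      unfolding power_mult_distrib using CN C2 by (intro mult_le_mono2) (meson le_trans mult_le_mono2)
    ultimately have "(r * C) ^ m * (C * (m * ((3 ^ m * 2 ^ (2 * r * (r - 1) * m) + 1) * C))) ^ r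
        \<le> r ^ m * (N * 2 ^ m) * ((8 * Q) ^ m) ^ r"
      by (rule mult_le_mono[rotated])
    also have "\<dots> = N * D ^ m"
      by (simp add: D_def power_mult_distrib power_mult[symmetric] mult.commute mult.left_commute)
    finally show ?thesis .
  qed
  moreover have "D \<ge> 2"
  proof -
    have "1 * 1 \<le> r * (8 * Q) ^ r" using assms by (intro mult_le_mono) (auto simp: Q_def Suc_le_eq)
    then show ?thesis by (simp add: D_def)
  qed
  ultimately show ?thesis by (intro exI[of _ D]) blast
qed

text \<open>Since \<open>m\<close> is at most a multiple of \<open>ln N / ln (ln N)\<close>, an
  exponential in \<open>m\<close> is a power of \<open>N\<close> with exponent of order
  \<open>1 / ln (ln N)\<close>.\<close>

lemma power_le_powr_loglog:
  fixes N D m :: nat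
  assumes "D \<ge> 2" "N > 0" "real m \<le> 21 * ln (real N) / ln (ln (real N))"
  shows "real (N * D ^ m) \<le> real N powr (1 + 21 * ln (real D) / ln (ln (real N)))"
proof -
  have "real (D ^ m) = exp (real m * ln (real D))" using assms(1) by (simp add: exp_of_nat_mult)
  also have "\<dots> \<le> exp (21 * ln (real N) / ln (ln (real N)) * ln (real D))"
    using mult_right_mono[OF assms(3), of "ln (real D)"] assms(1) by simp
  also have "\<dots> = real N powr (21 * ln (real D) / ln (ln (real N)))"
    using assms(2) by (simp add: powr_def mult.commute mult.left_commute)
  finally show ?thesis using assms(2) by (simp add: powr_add)
qed

theorem theorem1p2:
  fixes k :: nat
  assumes "k \<ge> 3"
  shows "\<exists>c::real. c > 0 \<and> (\<exists>\<epsilon>::nat \<Rightarrow> real. \<epsilon> \<longlonglongrightarrow> 0 \<and>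
    (\<forall>\<^sub>F n::nat in sequentially. \<exists>(V::nat set) E P.
        uniform_hypergraph (k - 1) V E \<and> card V = n \<and>
        real (card E) \<ge> (1 - \<epsilon> n) * real (n choose (k - 1)) \<and>
        induced_steiner_decomposition (k - 2) (k - 1) E P \<and>
        real (card P) \<le> real n powr (1 + c / ln (ln (real n)))))"
proof -
  define r where "r = k - 1"
  have r: "r \<ge> 2" "k - 2 = r - 1" using assms by (auto simp: r_def)
  obtain D :: nat where D: "D \<ge> 2" "\<And>C m N. C \<le> m \<Longrightarrow> C ^ m \<le> N * C \<Longrightarrow>
      (r * C) ^ m * (C * (m * ((3 ^ m * 2 ^ (2 * r * (r - 1) * m) + 1) * C))) ^ r \<le> N * D ^ m"
    using exists_class_count_base[of r] r(1) by auto
  \<comment> \<open>This dominates the loss of density for the chosen \<open>C\<close> and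
    \<open>m\<close>, yet depends on \<open>n\<close> alone.\<close>
  define \<epsilon> where "\<epsilon> n = 4 * (ln (real n) powr (- (1 / 2)) + 2 * ln (real n) powr (- (1 / 10))) * real (r choose 2)" for n
  have ln_lim: "filterlim (\<lambda>n. ln (real n)) at_top sequentially"
    by (rule filterlim_compose[OF ln_at_top filterlim_real_sequentially])
  have "\<epsilon> \<longlonglongrightarrow> 4 * (0 + 2 * 0) * real (r choose 2)"
    unfolding \<epsilon>_def by (intro tendsto_intros tendsto_neg_powr ln_lim) auto
  then have lim: "\<epsilon> \<longlonglongrightarrow> 0" by simp
  have "\<forall>\<^sub>F n in sequentially. ln (real n) \<ge> 2 ^ 20 \<and> n > 0"
    using ln_lim by (intro eventually_conj eventually_gt_at_top) (auto simp: filterlim_at_top)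
  then have "\<forall>\<^sub>F n in sequentially. \<exists>(V::nat set) E P.
      uniform_hypergraph r V E \<and> card V = n \<and>
      real (card E) \<ge> (1 - \<epsilon> n) * real (n choose r) \<and>
      induced_steiner_decomposition (r - 1) r E P \<and>
      real (card P) \<le> real n powr (1 + 21 * ln (real D) / ln (ln (real n)))"
  proof eventually_elim
    case (elim n)
    then obtain C m where Cm: "C \<ge> 2" "m > 0" "C \<le> m" "n \<le> C ^ m" "C ^ m \<le> n * C"
      "real m \<le> 21 * ln (real n) / ln (ln (real n))"
      "real C ^ 4 / real m + 1 / real C \<le> ln (real n) powr (- (1 / 2)) + 2 * ln (real n) powr (- (1 / 10))"
      using exists_base_and_dimension[of n] by blast
    obtain V :: "nat set" and E P where G: "uniform_hypergraph r V E" "card V = n"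
      "real (card E) \<ge> (1 - 4 * (real C ^ 4 / real m + 1 / real C) * real (r choose 2)) * real (n choose r)"
      "induced_steiner_decomposition (r - 1) r E P"
      "card P \<le> (r * C) ^ m * (C * (m * ((3 ^ m * 2 ^ (2 * r * (r - 1) * m) + 1) * C))) ^ r"
      using exists_decomposable_hypergraph[OF r(1) Cm(2,1,4)] by blast
    have "(1 - \<epsilon> n) * real (n choose r)
        \<le> (1 - 4 * (real C ^ 4 / real m + 1 / real C) * real (r choose 2)) * real (n choose r)"
      unfolding \<epsilon>_def using Cm(7) by (intro mult_right_mono diff_left_mono mult_left_mono) auto
    with G(3) have "(1 - \<epsilon> n) * real (n choose r) \<le> real (card E)" by (rule order_trans[rotated])
    moreover have "real (card P) \<le> real (n * D ^ m)"
      using le_trans[OF G(5) D(2)[OF Cm(3,5)]] by (simp only: of_nat_le_iff)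
    then have "real (card P) \<le> real n powr (1 + 21 * ln (real D) / ln (ln (real n)))"
      using power_le_powr_loglog[OF D(1) _ Cm(6)] elim by linarith
    ultimately show ?case using G(1,2,4) by blast
  qed
  \<comment> \<open>This is the constant \<open>c\<close>; it depends only on \<open>r\<close>,
    through \<open>D\<close>.\<close>
  moreover have "21 * ln (real D) > 0" using D(1) by simp
  ultimately show ?thesis using lim unfolding r(2) r_def[symmetric] by blast
qed

end
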